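(* In the setting of the context, suppose that both the system $$(\mathrm{HJB}_1)\quad\begin{cases}\partial_tV(t,x)+\frac12\mathrm{Tr}[\sigma\sigma^\top(t,x)\partial_{xx}V(t,x)]+H(t,t,x,\partial_xV(t,x))-\partial_s\mathcal J(t,t,x)=0,\\[0.3em] \partial_t\mathcal J(s,t,x)+\frac12\mathrm{Tr}[\sigma\sigma^\top(t,x)\partial_{xx}\mathcal J(s,t,x)]+\bar g\big(s,t,x,a^\star(t,t,x,\partial_xV(t,x)),\partial_x\mathcal J(s,t,x)\big)=0,\\[0.3em] V(T,x)=\xi(T,x),\quad\mathcal J(s,T,x)=\xi(s,x),\quad(s,x)\in[0,T]\times\mathbb R^n,\end{cases}$$ (the first two equations for $(s,t,x)\in\mathcal O$) for the unknown $(V,\mathcal J)\in C^{1,2}([0,T]\times\mathbb R^n)\times C^{1,1,2}([0,T]^2\times\mathbb R^n)$, and the equation $$(\mathrm{HJB}_2)\quad\begin{cases}\partial_t\mathcal V(s,t,x)+\frac12\mathrm{Tr}[\sigma\sigma^\top(t,x)\partial_{xx}\mathcal V(s,t,x)]+\bar g\big(s,t,x,a^\star(t,t,x,\partial_x\mathcal V(t,t,x)),\partial_x\mathcal V(s,t,x)\big)=0,&(s,t,x)\in\mathcal O,\\[0.3em] \mathcal V(s,T,x)=\xi(s,x),&(s,x)\in[0,T]\times\mathbb R^n,\end{cases}$$ for the unknown $\mathcal V\in C^{1,1,2}([0,T]^2\times\mathbb R^n)$, are well-posed (existence and uniqueness of a solution in the indicated class). Then: (i) if $(V,\mathcal J)\in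 C^{1,2}([0,T]\times\mathbb R^n)\times C^{1,1,2}([0,T]^2\times\mathbb R^n)$ solves $(\mathrm{HJB}_1)$, then $\mathcal V(s,t,x):=\mathcal J(s,t,x)$ solves $(\mathrm{HJB}_2)$; (ii) if $\mathcal V\in C^{1,1,2}([0,T]^2\times\mathbb R^n)$ solves $(\mathrm{HJB}_2)$, then $(V(t,x),\mathcal J(s,t,x)):=(\mathcal V(t,t,x),\mathcal V(s,t,x))$ solves $(\mathrm{HJB}_1)$.
   Context: Fix $T>0$ and positive integers $n,m,p$. $\sigma:[0,T]\times\mathbb R^n\to\mathbb R^{n\times m}$ is bounded and Borel. $A\subseteq\mathbb R^p$ is compact; $\bar f:[0,T]^2\times\mathbb R^n\times A\to\mathbb R$, $(s,t,x,a)\mapsto\bar f(s,t,x,a)$, is measurable and continuously differentiable in $s$; $b:[0,T]\times\mathbb R^n\times A\to\mathbb R^m$ is measurable and bounded; $\xi:[0,T]\times\mathbb R^n\to\mathbb R$ is measurable and continuously differentiable in its first variable. Define $$\bar g(s,t,x,a,v):=\bar f(s,t,x,a)+v\cdot\sigma(t,x)b(t,x,a),\qquad H(s,t,x,v):=\sup_{a\in A}\bar g(s,t,x,a,v),\quad v\in\mathbb R^n,$$ and assume there is a measurable $a^\star:[0,T]^2\times\mathbb R^n\times\mathbb R^n\to A$ with $\bar g(s,t,x,a^\star(s,t,x,v),v)=H(s,t,x,v)$ for all arguments. $\mathcal O:=[0,T)\times[0,T]\times\mathbb R^n$. $C^{1,2}$ (resp. $C^{1,1,2}$): real-valued functions continuously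 differentiable once in $t$ (resp. once in $s$ and once in $t$) and twice in $x$. $\partial_t\mathcal V(s,t,x)$ and $\partial_s\mathcal V(s,t,x)$ denote derivatives in the second and first arguments respectively; $\partial_s\mathcal J(t,t,x)$ is $\partial_s\mathcal J(s,t,x)$ evaluated at $s=t$. *)

theory Defs
  imports "HOL-Analysis.Analysis"
begin

text \<open>All functions are total in HOL; their values for times outside \<open>[0,T]\<close> or controls outside \<open>A\<close>
  are irrelevant. Time derivatives are taken within \<open>{0..T}\<close>, hence one-sided at the end points.\<close>

definition time_deriv :: "real \<Rightarrow> (real \<Rightarrow> real) \<Rightarrow> real \<Rightarrow> real" where
  "time_deriv T f t = vector_derivative f (at t within {0..T})"

definition C1_time :: "real \<Rightarrow> (real \<Rightarrow> real) \<Rightarrow> bool" where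
  "C1_time T f \<longleftrightarrow>
     (\<forall>t\<in>{0..T}. f differentiable (at t within {0..T})) \<and> continuous_on {0..T} (time_deriv T f)"

definition grad :: "(real^'n \<Rightarrow> real) \<Rightarrow> real^'n \<Rightarrow> real^'n" where
  "grad f x = (\<chi> i. frechet_derivative f (at x) (axis i 1))"

definition hessian :: "(real^'n \<Rightarrow> real) \<Rightarrow> real^'n \<Rightarrow> real^'n^'n" where
  "hessian f x = jacobian (grad f) (at x)"

definition twice_diff :: "(real^'n \<Rightarrow> real) \<Rightarrow> bool" where
  "twice_diff f \<longleftrightarrow> (\<forall>x. f differentiable (at x) \<and> grad f differentiable (at x))"

text \<open>All derivatives occurring in the two classes below are jointly continuous in all variables;
  no mixed time/space or second time derivatives are required to exist.\<close>

definition C12 :: "real \<Rightarrow> (real \<Rightarrow> real^'n \<Rightarrow> real) \<Rightarrow> bool" where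
  "C12 T V \<longleftrightarrow>
     (\<forall>t\<in>{0..T}. twice_diff (V t) \<and>
        (\<forall>x. (\<lambda>r. V r x) differentiable (at t within {0..T}))) \<and>
     continuous_on ({0..T} \<times> UNIV) (\<lambda>(t, x). V t x) \<and>
     continuous_on ({0..T} \<times> UNIV) (\<lambda>(t, x). time_deriv T (\<lambda>r. V r x) t) \<and>
     continuous_on ({0..T} \<times> UNIV) (\<lambda>(t, x). grad (V t) x) \<and>
     continuous_on ({0..T} \<times> UNIV) (\<lambda>(t, x). hessian (V t) x)"

definition C112 :: "real \<Rightarrow> (real \<Rightarrow> real \<Rightarrow> real^'n \<Rightarrow> real) \<Rightarrow> bool" where
  "C112 T J \<longleftrightarrow>
     (\<forall>s\<in>{0..T}. \<forall>t\<in>{0..T}. twice_diff (J s t) \<and>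
        (\<forall>x. (\<lambda>r. J r t x) differentiable (at s within {0..T}) \<and>
             (\<lambda>r. J s r x) differentiable (at t within {0..T}))) \<and>
     continuous_on ({0..T} \<times> {0..T} \<times> UNIV) (\<lambda>(s, t, x). J s t x) \<and>
     continuous_on ({0..T} \<times> {0..T} \<times> UNIV) (\<lambda>(s, t, x). time_deriv T (\<lambda>r. J r t x) s) \<and>
     continuous_on ({0..T} \<times> {0..T} \<times> UNIV) (\<lambda>(s, t, x). time_deriv T (\<lambda>r. J s r x) t) \<and>
     continuous_on ({0..T} \<times> {0..T} \<times> UNIV) (\<lambda>(s, t, x). grad (J s t) x) \<and>
     continuous_on ({0..T} \<times> {0..T} \<times> UNIV) (\<lambda>(s, t, x). hessian (J s t) x)"

definition gbar ::
  "(real \<Rightarrow> real^'n \<Rightarrow> real^'m^'n) \<Rightarrow> (real \<Rightarrow> real^'n \<Rightarrow> real^'p \<Rightarrow> real^'m) \<Rightarrow>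
   (real \<Rightarrow> real \<Rightarrow> real^'n \<Rightarrow> real^'p \<Rightarrow> real) \<Rightarrow>
   real \<Rightarrow> real \<Rightarrow> real^'n \<Rightarrow> real^'p \<Rightarrow> real^'n \<Rightarrow> real" where
  "gbar \<sigma> b f s t x a v = f s t x a + v \<bullet> (\<sigma> t x *v b t x a)"

text \<open>A real supremum: meaningful only where the set of values is nonempty and bounded above.\<close>

definition Ham ::
  "(real^'p) set \<Rightarrow> (real \<Rightarrow> real^'n \<Rightarrow> real^'m^'n) \<Rightarrow> (real \<Rightarrow> real^'n \<Rightarrow> real^'p \<Rightarrow> real^'m) \<Rightarrow>
   (real \<Rightarrow> real \<Rightarrow> real^'n \<Rightarrow> real^'p \<Rightarrow> real) \<Rightarrow>
   real \<Rightarrow> real \<Rightarrow> real^'n \<Rightarrow> real^'n \<Rightarrow> real" where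
  "Ham A \<sigma> b f s t x v = (SUP a\<in>A. gbar \<sigma> b f s t x a v)"

definition diffusion_term :: "real^'m^'n \<Rightarrow> real^'n^'n \<Rightarrow> real" where
  "diffusion_term S M = 1/2 * trace ((S ** transpose S) ** M)"

definition hjb_domain :: "real \<Rightarrow> (real \<times> real \<times> (real^'n)) set" where
  "hjb_domain T = {0..<T} \<times> {0..T} \<times> UNIV"

definition HJB1_solution ::
  "real \<Rightarrow> (real^'p) set \<Rightarrow> (real \<Rightarrow> real^'n \<Rightarrow> real^'m^'n) \<Rightarrow> (real \<Rightarrow> real^'n \<Rightarrow> real^'p \<Rightarrow> real^'m) \<Rightarrow>
   (real \<Rightarrow> real \<Rightarrow> real^'n \<Rightarrow> real^'p \<Rightarrow> real) \<Rightarrow> (real \<Rightarrow> real^'n \<Rightarrow> real) \<Rightarrow>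
   (real \<Rightarrow> real \<Rightarrow> real^'n \<Rightarrow> real^'n \<Rightarrow> real^'p) \<Rightarrow>
   (real \<Rightarrow> real^'n \<Rightarrow> real) \<Rightarrow> (real \<Rightarrow> real \<Rightarrow> real^'n \<Rightarrow> real) \<Rightarrow> bool" where
  "HJB1_solution T A \<sigma> b f \<xi> astar V J \<longleftrightarrow>
     C12 T V \<and> C112 T J \<and>
     (\<forall>(s, t, x) \<in> hjb_domain T.
        time_deriv T (\<lambda>r. V r x) t + diffusion_term (\<sigma> t x) (hessian (V t) x)
        + Ham A \<sigma> b f t t x (grad (V t) x) - time_deriv T (\<lambda>r. J r t x) t = 0) \<and>
     (\<forall>(s, t, x) \<in> hjb_domain T.
        time_deriv T (\<lambda>r. J s r x) t + diffusion_term (\<sigma> t x) (hessian (J s t) x)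
        + gbar \<sigma> b f s t x (astar t t x (grad (V t) x)) (grad (J s t) x) = 0) \<and>
     (\<forall>s\<in>{0..T}. \<forall>x. V T x = \<xi> T x \<and> J s T x = \<xi> s x)"

definition HJB2_solution ::
  "real \<Rightarrow> (real \<Rightarrow> real^'n \<Rightarrow> real^'m^'n) \<Rightarrow> (real \<Rightarrow> real^'n \<Rightarrow> real^'p \<Rightarrow> real^'m) \<Rightarrow>
   (real \<Rightarrow> real \<Rightarrow> real^'n \<Rightarrow> real^'p \<Rightarrow> real) \<Rightarrow> (real \<Rightarrow> real^'n \<Rightarrow> real) \<Rightarrow>
   (real \<Rightarrow> real \<Rightarrow> real^'n \<Rightarrow> real^'n \<Rightarrow> real^'p) \<Rightarrow>
   (real \<Rightarrow> real \<Rightarrow> real^'n \<Rightarrow> real) \<Rightarrow> bool" where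
  "HJB2_solution T \<sigma> b f \<xi> astar W \<longleftrightarrow>
     C112 T W \<and>
     (\<forall>(s, t, x) \<in> hjb_domain T.
        time_deriv T (\<lambda>r. W s r x) t + diffusion_term (\<sigma> t x) (hessian (W s t) x)
        + gbar \<sigma> b f s t x (astar t t x (grad (W t t) x)) (grad (W s t) x) = 0) \<and>
     (\<forall>s\<in>{0..T}. \<forall>x. W s T x = \<xi> s x)"

text \<open>Uniqueness is equality on the domain, since the functions are unconstrained outside it.\<close>

definition HJB1_well_posed ::
  "real \<Rightarrow> (real^'p) set \<Rightarrow> (real \<Rightarrow> real^'n \<Rightarrow> real^'m^'n) \<Rightarrow> (real \<Rightarrow> real^'n \<Rightarrow> real^'p \<Rightarrow> real^'m) \<Rightarrow>
   (real \<Rightarrow> real \<Rightarrow> real^'n \<Rightarrow> real^'p \<Rightarrow> real) \<Rightarrow> (real \<Rightarrow> real^'n \<Rightarrow> real) \<Rightarrow>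
   (real \<Rightarrow> real \<Rightarrow> real^'n \<Rightarrow> real^'n \<Rightarrow> real^'p) \<Rightarrow> bool" where
  "HJB1_well_posed T A \<sigma> b f \<xi> astar \<longleftrightarrow>
     (\<exists>V J. HJB1_solution T A \<sigma> b f \<xi> astar V J) \<and>
     (\<forall>V J V' J'. HJB1_solution T A \<sigma> b f \<xi> astar V J \<longrightarrow> HJB1_solution T A \<sigma> b f \<xi> astar V' J' \<longrightarrow>
        (\<forall>t\<in>{0..T}. \<forall>x. V t x = V' t x) \<and>
        (\<forall>s\<in>{0..T}. \<forall>t\<in>{0..T}. \<forall>x. J s t x = J' s t x))"

definition HJB2_well_posed ::
  "real \<Rightarrow> (real \<Rightarrow> real^'n \<Rightarrow> real^'m^'n) \<Rightarrow> (real \<Rightarrow> real^'n \<Rightarrow> real^'p \<Rightarrow> real^'m) \<Rightarrow>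
   (real \<Rightarrow> real \<Rightarrow> real^'n \<Rightarrow> real^'p \<Rightarrow> real) \<Rightarrow> (real \<Rightarrow> real^'n \<Rightarrow> real) \<Rightarrow>
   (real \<Rightarrow> real \<Rightarrow> real^'n \<Rightarrow> real^'n \<Rightarrow> real^'p) \<Rightarrow> bool" where
  "HJB2_well_posed T \<sigma> b f \<xi> astar \<longleftrightarrow>
     (\<exists>W. HJB2_solution T \<sigma> b f \<xi> astar W) \<and>
     (\<forall>W W'. HJB2_solution T \<sigma> b f \<xi> astar W \<longrightarrow> HJB2_solution T \<sigma> b f \<xi> astar W' \<longrightarrow>
        (\<forall>s\<in>{0..T}. \<forall>t\<in>{0..T}. \<forall>x. W s t x = W' s t x))"

end

theory Submission
  imports Defs
begin

text \<open>
  The equation for \<open>V\<close> is the restriction of the parametrised equation to the diagonal. If \<open>W\<close> solves the equation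
  with parameter \<open>s\<close>, then \<open>V t x = W t t x\<close> has time derivative
  \<open>\<partial>\<^sub>s W t t x + \<partial>\<^sub>t W t t x\<close> by the chain rule, while its space derivatives are those of \<open>W t t\<close>.
  Evaluating the equation of \<open>W\<close> at \<open>s = t\<close> therefore gives the equation for \<open>V\<close>, because
  \<open>astar t t x (grad (W t t) x)\<close> attains the Hamiltonian. This is part (ii). The only delicate point
  is the terminal time: the equation for \<open>V\<close> is required at \<open>t = T\<close>, where the diagonal point
  \<open>s = t = T\<close> is excluded from the domain of the equation for \<open>W\<close>. The control in that equation depends
  on \<open>t\<close> and \<open>x\<close> but not on \<open>s\<close>, so for fixed \<open>t\<close> and \<open>x\<close> its left-hand side is continuous in \<open>s\<close>,
  although \<open>\<sigma>\<close>, \<open>b\<close> and \<open>astar\<close> need not be continuous; hence it vanishes at \<open>s = T\<close> too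
  (\<open>HJB2_equation_closed\<close>).

  For part (i), subtracting the equations shows that \<open>V t x - J t t x\<close> solves a linear homogeneous
  equation with zero terminal value, but its vanishing would require a separate uniqueness result.
  The assumed well-posedness gives it directly: the second problem has a solution \<open>W\<close>, and by
  part (ii) its diagonal together with \<open>W\<close> solves the first problem. Uniqueness there identifies any
  solution \<open>(V, J)\<close> with this one, so that \<open>V t x = J t t x\<close>; replacing \<open>grad (V t)\<close> by
  \<open>grad (J t t)\<close> in the equation for \<open>J\<close> gives the claim.
\<close>

section \<open>Differentiation along the diagonal\<close>

text \<open>Continuity of one of the two partial derivatives makes \<open>F\<close> totally differentiable at \<open>(a, a)\<close>;
  the total derivative is then composed with \<open>r \<mapsto> (r, r)\<close>. The existence of partial derivatives
  alone would not be enough, which is why \<open>cont\<close> asks for joint continuity.\<close>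

lemma has_vector_derivative_diagonal:
  fixes F :: "real \<Rightarrow> real \<Rightarrow> 'b::real_normed_vector"
  assumes first: "((\<lambda>r. F r a) has_vector_derivative u) (at a within S)"
    and second: "\<And>s t. s \<in> S \<Longrightarrow> t \<in> S \<Longrightarrow> ((\<lambda>r. F s r) has_vector_derivative D s t) (at t within S)"
    and cont: "continuous_on (S \<times> S) (\<lambda>(s, t). D s t)"
    and a: "a \<in> S" and S: "convex S"
  shows "((\<lambda>r. F r r) has_vector_derivative (u + D a a)) (at a within S)"
proof -
  have "continuous_on (S \<times> S) (\<lambda>(s, t). blinfun_scaleR_left (D s t))"
    using cont by (auto simp: split_beta intro!: continuous_intros)
  then have "continuous (at (a, a) within S \<times> S) (\<lambda>(s, t). blinfun_scaleR_left (D s t))"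
    using a by (auto simp: continuous_on_eq_continuous_within)
  then have "((\<lambda>(x, y). F x y) has_derivative
      (\<lambda>(x, y). x *\<^sub>R u + blinfun_apply (blinfun_scaleR_left (D a a)) y)) (at (a, a) within S \<times> S)"
    using first second a S
    by (intro has_derivative_partialsI) (auto simp: has_vector_derivative_def)
  then have total: "((\<lambda>(x, y). F x y) has_derivative (\<lambda>(x, y). x *\<^sub>R u + y *\<^sub>R D a a))
      (at (a, a) within S \<times> S)"
    by simp
  have diag: "((\<lambda>r. (r, r)) has_derivative (\<lambda>h. (h, h))) (at a within S)"
    by (auto intro!: derivative_eq_intros)
  have "((\<lambda>(x, y). F x y) has_derivative (\<lambda>(x, y). x *\<^sub>R u + y *\<^sub>R D a a))
      (at (a, a) within (\<lambda>r. (r, r)) ` S)"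
    by (rule has_derivative_subset[OF total]) auto
  from has_derivative_in_compose[OF diag this] show ?thesis
    by (simp add: has_vector_derivative_def scaleR_add_right)
qed

lemma has_vector_derivative_time_deriv:
  assumes "g differentiable (at t within {0..T})"
  shows "(g has_vector_derivative time_deriv T g t) (at t within {0..T})"
  using assms by (simp add: time_deriv_def vector_derivative_works[symmetric])

lemma C112_has_vector_derivative_diagonal:
  assumes W: "C112 T W" and t: "t \<in> {0..T}"
  shows "((\<lambda>r. W r r x) has_vector_derivative
           (time_deriv T (\<lambda>r. W r t x) t + time_deriv T (\<lambda>r. W t r x) t)) (at t within {0..T})"
proof (rule has_vector_derivative_diagonal[where F = "\<lambda>s r. W s r x"
      and D = "\<lambda>s t. time_deriv T (\<lambda>r. W s r x) t"])
  show "((\<lambda>r. W r t x) has_vector_derivative time_deriv T (\<lambda>r. W r t x) t) (at t within {0..T})"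
    using W t by (intro has_vector_derivative_time_deriv) (auto simp: C112_def)
  show "((\<lambda>r. W s r x) has_vector_derivative time_deriv T (\<lambda>r. W s r x) t') (at t' within {0..T})"
    if "s \<in> {0..T}" "t' \<in> {0..T}" for s t'
    using W that by (intro has_vector_derivative_time_deriv) (auto simp: C112_def)
  have "continuous_on ({0..T} \<times> {0..T} \<times> UNIV) (\<lambda>(s, t, x). time_deriv T (\<lambda>r. W s r x) t)"
    using W by (simp add: C112_def)
  then have "continuous_on ({0..T} \<times> {0..T})
      ((\<lambda>(s, t, x). time_deriv T (\<lambda>r. W s r x) t) \<circ> (\<lambda>(s, t). (s, t, x)))"
    by (intro continuous_on_compose) (auto simp: split_beta intro!: continuous_intros elim!: continuous_on_subset)
  then show "continuous_on ({0..T} \<times> {0..T}) (\<lambda>(s, t). time_deriv T (\<lambda>r. W s r x) t)"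
    by (simp add: o_def split_beta)
qed (use t in auto)

lemma time_deriv_diagonal:
  assumes "0 < T" and "C112 T W" and "t \<in> {0..T}"
  shows "time_deriv T (\<lambda>r. W r r x) t = time_deriv T (\<lambda>r. W r t x) t + time_deriv T (\<lambda>r. W t r x) t"
  using vector_derivative_within_closed_interval[OF assms(1,3)
      C112_has_vector_derivative_diagonal[OF assms(2,3)]]
  by (simp add: time_deriv_def)

lemma continuous_on_diagonal:
  fixes F :: "'a::topological_space \<Rightarrow> 'a \<Rightarrow> 'b::topological_space \<Rightarrow> 'c::topological_space"
  assumes "continuous_on (S \<times> S \<times> UNIV) (\<lambda>(s, t, x). F s t x)"
  shows "continuous_on (S \<times> UNIV) (\<lambda>(t, x). F t t x)"
proof -
  have "continuous_on (S \<times> UNIV) ((\<lambda>(s, t, x). F s t x) \<circ> (\<lambda>(t, x). (t, t, x)))"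
    by (intro continuous_on_compose continuous_on_subset[OF assms])
      (auto simp: split_beta intro!: continuous_intros)
  then show ?thesis
    by (simp add: o_def split_beta)
qed

lemma C12_diagonal:
  fixes W :: "real \<Rightarrow> real \<Rightarrow> real^'n \<Rightarrow> real"
  assumes T: "0 < T" and W: "C112 T W"
  shows "C12 T (\<lambda>t x. W t t x)"
  unfolding C12_def
proof (intro conjI ballI allI)
  show "twice_diff (W t t)" if "t \<in> {0..T}" for t
    using W that by (simp add: C112_def)
  show "(\<lambda>r. W r r x) differentiable at t within {0..T}" if "t \<in> {0..T}" for t x
    using C112_has_vector_derivative_diagonal[OF W that]
    by (auto simp: has_vector_derivative_def differentiable_def)
  have "continuous_on ({0..T} \<times> UNIV)
      (\<lambda>(t, x). time_deriv T (\<lambda>r. W r t x) t + time_deriv T (\<lambda>r. W t r x) t)"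
    using W continuous_on_diagonal[of "{0..T}" "\<lambda>s t x. time_deriv T (\<lambda>r. W r t x) s"]
      continuous_on_diagonal[of "{0..T}" "\<lambda>s t x. time_deriv T (\<lambda>r. W s r x) t"]
    by (auto simp: C112_def split_beta intro!: continuous_on_add)
  then show "continuous_on ({0..T} \<times> UNIV) (\<lambda>(t, x). time_deriv T (\<lambda>r. W r r x) t)"
    by (rule continuous_on_eq) (auto simp: time_deriv_diagonal[OF T W])
  show "continuous_on ({0..T} \<times> UNIV) (\<lambda>(t, x). W t t x)"
    using W by (intro continuous_on_diagonal) (simp add: C112_def)
  show "continuous_on ({0..T} \<times> UNIV) (\<lambda>(t, x). grad (W t t) x)"
    using W by (intro continuous_on_diagonal[where F = "\<lambda>s t. grad (W s t)"]) (simp add: C112_def)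
  show "continuous_on ({0..T} \<times> UNIV) (\<lambda>(t, x). hessian (W t t) x)"
    using W by (intro continuous_on_diagonal[where F = "\<lambda>s t. hessian (W s t)"]) (simp add: C112_def)
qed

section \<open>The equation up to the terminal parameter\<close>

lemma C112_continuous_on_parameter:
  fixes G :: "real \<Rightarrow> real \<Rightarrow> real^'n \<Rightarrow> 'c::topological_space"
  assumes "continuous_on ({0..T} \<times> {0..T} \<times> UNIV) (\<lambda>(s, t, x). G s t x)" and "t \<in> {0..T}"
  shows "continuous_on {0..T} (\<lambda>s. G s t x)"
proof -
  have "continuous_on {0..T} ((\<lambda>(s, t, x). G s t x) \<circ> (\<lambda>s. (s, t, x)))"
    using assms(2)
    by (intro continuous_on_compose continuous_on_subset[OF assms(1)])
      (auto intro!: continuous_intros)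
  then show ?thesis
    by (simp add: o_def)
qed

lemma continuous_on_diffusion_term:
  assumes "continuous_on S M"
  shows "continuous_on S (\<lambda>s. diffusion_term B (M s))"
  using assms
  by (auto simp: diffusion_term_def trace_def matrix_matrix_mult_def intro!: continuous_intros)

text \<open>The equation for \<open>W\<close> is imposed for \<open>s < T\<close> only. With \<open>t\<close> and \<open>x\<close> fixed, the coefficients
  \<open>\<sigma>\<close> and \<open>b\<close> and the control are constants, so everything that still depends on \<open>s\<close> is a derivative
  of \<open>W\<close> or the \<open>C\<^sup>1\<close> function \<open>f\<close>; letting \<open>s\<close> increase to \<open>T\<close> gives the equation at \<open>s = T\<close>.\<close>

lemma HJB2_equation_closed:
  fixes \<sigma> :: "real \<Rightarrow> real^'n \<Rightarrow> real^'m^'n"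
    and b :: "real \<Rightarrow> real^'n \<Rightarrow> real^'p \<Rightarrow> real^'m"
  assumes T: "0 < T"
    and W: "HJB2_solution T \<sigma> b f \<xi> astar W"
    and s: "s \<in> {0..T}" and t: "t \<in> {0..T}"
    and f: "C1_time T (\<lambda>s. f s t x (astar t t x (grad (W t t) x)))"
  shows "time_deriv T (\<lambda>r. W s r x) t + diffusion_term (\<sigma> t x) (hessian (W s t) x)
        + gbar \<sigma> b f s t x (astar t t x (grad (W t t) x)) (grad (W s t) x) = 0"
proof -
  have C: "C112 T W"
    using W by (simp add: HJB2_solution_def)
  define a where "a = astar t t x (grad (W t t) x)"
  define h where "h s = time_deriv T (\<lambda>r. W s r x) t + diffusion_term (\<sigma> t x) (hessian (W s t) x)
        + gbar \<sigma> b f s t x a (grad (W s t) x)" for s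
  have "continuous_on {0..T} (\<lambda>s. f s t x a)"
    using f unfolding a_def C1_time_def continuous_on_eq_continuous_within
    by (blast intro: differentiable_imp_continuous_within)
  moreover have "continuous_on {0..T} (\<lambda>s. time_deriv T (\<lambda>r. W s r x) t)"
    using C t by (intro C112_continuous_on_parameter[where G = "\<lambda>s t x. time_deriv T (\<lambda>r. W s r x) t"])
      (auto simp: C112_def)
  moreover have "continuous_on {0..T} (\<lambda>s. grad (W s t) x)"
    using C t by (intro C112_continuous_on_parameter[where G = "\<lambda>s t x. grad (W s t) x"])
      (auto simp: C112_def)
  moreover have "continuous_on {0..T} (\<lambda>s. hessian (W s t) x)"
    using C t by (intro C112_continuous_on_parameter[where G = "\<lambda>s t x. hessian (W s t) x"])
      (auto simp: C112_def)
  ultimately have "continuous_on {0..T} h"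
    unfolding h_def gbar_def by (intro continuous_intros continuous_on_diffusion_term)
  moreover have "h s = 0" if "s \<in> {0..<T}" for s
    using W that t by (auto simp: HJB2_solution_def hjb_domain_def h_def a_def)
  ultimately have "h s = 0"
    using continuous_constant_on_closure[of "{0..<T}" h 0 s] T s by auto
  then show ?thesis
    by (simp add: h_def a_def)
qed

section \<open>Equivalence of the two systems\<close>

lemma HJB1_solution_diagonal:
  fixes \<sigma> :: "real \<Rightarrow> real^'n \<Rightarrow> real^'m^'n"
    and b :: "real \<Rightarrow> real^'n \<Rightarrow> real^'p \<Rightarrow> real^'m"
  assumes T: "0 < T"
    and f: "\<And>t x a. t \<in> {0..T} \<Longrightarrow> a \<in> A \<Longrightarrow> C1_time T (\<lambda>s. f s t x a)"
    and astar_in: "\<And>t x v. t \<in> {0..T} \<Longrightarrow> astar t t x v \<in> A"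
    and astar_max: "\<And>t x v. t \<in> {0..T} \<Longrightarrow>
          gbar \<sigma> b f t t x (astar t t x v) v = Ham A \<sigma> b f t t x v"
    and W: "HJB2_solution T \<sigma> b f \<xi> astar W"
  shows "HJB1_solution T A \<sigma> b f \<xi> astar (\<lambda>t x. W t t x) W"
proof -
  have C: "C112 T W"
    using W by (simp add: HJB2_solution_def)
  have "time_deriv T (\<lambda>r. W r r x) t + diffusion_term (\<sigma> t x) (hessian (W t t) x)
        + Ham A \<sigma> b f t t x (grad (W t t) x) - time_deriv T (\<lambda>r. W r t x) t = 0"
    if t: "t \<in> {0..T}" for t x
    using HJB2_equation_closed[OF T W t t f[OF t astar_in[OF t]], of x]
    by (simp add: time_deriv_diagonal[OF T C t] astar_max[OF t])
  then show ?thesis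
    using W C C12_diagonal[OF T C] T
    by (auto simp: HJB1_solution_def HJB2_solution_def hjb_domain_def)
qed

text \<open>On the diagonal the two controls \<open>astar t t x (grad (V t) x)\<close> and
  \<open>astar t t x (grad (J t t) x)\<close> agree, and this is the only difference between the equations
  for \<open>J\<close>.\<close>

lemma HJB2_solution_if_diagonal:
  assumes VJ: "HJB1_solution T A \<sigma> b f \<xi> astar V J"
    and diag: "\<And>t x. t \<in> {0..T} \<Longrightarrow> V t x = J t t x"
  shows "HJB2_solution T \<sigma> b f \<xi> astar J"
proof -
  have "V t = J t t" if "t \<in> {0..T}" for t
    using diag[OF that] by blast
  then show ?thesis
    using VJ by (auto simp: HJB1_solution_def HJB2_solution_def hjb_domain_def)
qed

theorem theorem5p3:
  fixes T :: real
    and A :: "(real^'p) set"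
    and \<sigma> :: "real \<Rightarrow> real^'n \<Rightarrow> real^'m^'n"
    and b :: "real \<Rightarrow> real^'n \<Rightarrow> real^'p \<Rightarrow> real^'m"
    and f :: "real \<Rightarrow> real \<Rightarrow> real^'n \<Rightarrow> real^'p \<Rightarrow> real"
    and \<xi> :: "real \<Rightarrow> real^'n \<Rightarrow> real"
    and astar :: "real \<Rightarrow> real \<Rightarrow> real^'n \<Rightarrow> real^'n \<Rightarrow> real^'p"
  assumes T_pos: "0 < T"
    and sigma_borel: "(\<lambda>(t, x). \<sigma> t x) \<in> borel_measurable (restrict_space borel ({0..T} \<times> UNIV))"
    and sigma_bounded: "bounded ((\<lambda>(t, x). \<sigma> t x) ` ({0..T} \<times> UNIV))"
    and A_compact: "compact A"
    and f_measurable: "(\<lambda>(s, t, x, a). f s t x a)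
          \<in> borel_measurable (restrict_space borel ({0..T} \<times> {0..T} \<times> UNIV \<times> A))"
    and f_C1: "\<And>t x a. t \<in> {0..T} \<Longrightarrow> a \<in> A \<Longrightarrow> C1_time T (\<lambda>s. f s t x a)"
    and b_measurable: "(\<lambda>(t, x, a). b t x a)
          \<in> borel_measurable (restrict_space borel ({0..T} \<times> UNIV \<times> A))"
    and b_bounded: "bounded ((\<lambda>(t, x, a). b t x a) ` ({0..T} \<times> UNIV \<times> A))"
    and xi_measurable: "(\<lambda>(s, x). \<xi> s x) \<in> borel_measurable (restrict_space borel ({0..T} \<times> UNIV))"
    and xi_C1: "\<And>x. C1_time T (\<lambda>s. \<xi> s x)"
    and H_finite: "\<And>s t x v. s \<in> {0..T} \<Longrightarrow> t \<in> {0..T} \<Longrightarrow>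
          bdd_above ((\<lambda>a. gbar \<sigma> b f s t x a v) ` A)"
    and astar_measurable: "(\<lambda>(s, t, x, v). astar s t x v)
          \<in> measurable (restrict_space borel ({0..T} \<times> {0..T} \<times> UNIV \<times> UNIV)) (restrict_space borel A)"
    and astar_max: "\<And>s t x v. s \<in> {0..T} \<Longrightarrow> t \<in> {0..T} \<Longrightarrow>
          gbar \<sigma> b f s t x (astar s t x v) v = Ham A \<sigma> b f s t x v"
    and HJB1_wp: "HJB1_well_posed T A \<sigma> b f \<xi> astar"
    and HJB2_wp: "HJB2_well_posed T \<sigma> b f \<xi> astar"
  shows "(\<forall>V J. HJB1_solution T A \<sigma> b f \<xi> astar V J \<longrightarrow>
            HJB2_solution T \<sigma> b f \<xi> astar (\<lambda>s t x. J s t x)) \<and>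
         (\<forall>W. HJB2_solution T \<sigma> b f \<xi> astar W \<longrightarrow>
            HJB1_solution T A \<sigma> b f \<xi> astar (\<lambda>t x. W t t x) (\<lambda>s t x. W s t x))"
proof -
  (* f is regular in s only for controls in A; that astar takes values in A is contained in the
     target space of its measurability hypothesis. *)
  have astar_in: "astar t t x v \<in> A" if "t \<in> {0..T}" for t x v
  proof -
    have "(t, t, x, v) \<in> space (restrict_space borel ({0..T} \<times> {0..T} \<times> UNIV \<times> UNIV))"
      using that by (simp add: space_restrict_space)
    from measurable_space[OF astar_measurable this] show ?thesis
      by (simp add: space_restrict_space)
  qed
  have part_ii: "HJB1_solution T A \<sigma> b f \<xi> astar (\<lambda>t x. W t t x) W"
    if "HJB2_solution T \<sigma> b f \<xi> astar W" for W
    using T_pos f_C1 astar_in astar_max that by (rule HJB1_solution_diagonal)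
  have part_i: "HJB2_solution T \<sigma> b f \<xi> astar J" if VJ: "HJB1_solution T A \<sigma> b f \<xi> astar V J" for V J
  proof -
    obtain W where W: "HJB2_solution T \<sigma> b f \<xi> astar W"
      using HJB2_wp by (auto simp: HJB2_well_posed_def)
    have "(\<forall>t\<in>{0..T}. \<forall>x. V t x = W t t x) \<and> (\<forall>s\<in>{0..T}. \<forall>t\<in>{0..T}. \<forall>x. J s t x = W s t x)"
      using HJB1_wp VJ part_ii[OF W] unfolding HJB1_well_posed_def by blast
    then show ?thesis
      by (intro HJB2_solution_if_diagonal[OF VJ]) simp
  qed
  show ?thesis
    using part_i part_ii by blast
qed

end
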